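(* Let $(\Omega,\Sigma,\mu)$ be a measure space with the direct sum property, let $\nabla$ be the set of idempotents of $L^\infty(\Omega)$, and let $(S,\Xi,\nu)$ be a measure space. Let $k(t,s,\omega)$ be a complex-valued measurable function on $S^2\times\Omega$ such that $\int_S\int_S|k(t,s,\omega)|^2\,d\nu(t)\,d\nu(s)\in L^\infty(\Omega)$, and suppose that $k(t,s,\omega)=\overline{k(s,t,\omega)}$. Let $T$ be the operator on $L^{2,\infty}(S\times\Omega)$ given by $T(f)(t,\omega)=\int_Sk(t,s,\omega)f(s,\omega)\,d\nu(s)$, and let $\{\Omega_k\}$, $\{g_{k,n}\}$, $\{\lambda_{k,n}\}$ be a spectral representation of $T$ (as defined in the context). Let $\lambda\in L^\infty(\Omega)$. Then the partial integral equation $$\int_Sk(t,s,\omega)f(s,\omega)\,d\nu(s)=\lambda(\omega)f(t,\omega),\qquad f\in L^{2,\infty}(S\times\Omega),$$ is solvable (that is, has a non-zero solution $f$) if and only if there exist a non-zero $\pi\in\nabla$ and some $\lambda_{k,n}$ such that $\pi\lambda=\pi\lambda_{k,n}$.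
   Context: Direct sum property of $\mu$: there is a family $\{\Omega_i'\}_{i\in J}\subset\Sigma$ with $0<\mu(\Omega_i')<+\infty$ such that for every $A\in\Sigma$ with $\mu(A)<+\infty$ there are a countable $J_0\subset J$ and a null set $B$ with $A=\bigcup_{i\in J_0}(A\cap\Omega_i')\cup B$. $L^\infty(\Omega)$ is the algebra of (classes of) bounded complex measurable functions on $\Omega$. $L^{2,\infty}(S\times\Omega)$ is the space of (a.e.-equivalence classes of) complex measurable functions $f$ on $S\times\Omega$ with $\int_S|f(s,\omega)|^2\,d\nu(s)\in L^\infty(\Omega)$. It is an $L^\infty(\Omega)$-module (with $(af)(s,\omega)=a(\omega)f(s,\omega)$) with the $L^\infty(\Omega)$-valued inner product $\langle f,g\rangle(\omega)=\int_Sf(s,\omega)\overline{g(s,\omega)}\,d\nu(s)$. Spectral representation of $T$: a measurable partition $\{\Omega_0,\Omega_1,\ldots,\Omega_k,\ldots,\Omega_\infty\}$ of $\Omega$ together with, for every $k\in\{1,2,\ldots\}\cup\{\infty\}$, an orthonormal family $\{g_{k,n}\}_{n=1}^{k}$ in $\chi_{\Omega_k}L^{2,\infty}(S\times\Omega)$ (i.e. $\langle g_{k,n},g_{k,m}\rangle=0$ for $n\neq m$ and $\langle g_{k,n},g_{k,n}\rangle=\chi_{\Omega_k}$) and a family $\{\lambda_{k,n}\}_{n=1}^{k}$ in $\chi_{\Omega_k}L^\infty(\Omega)$ (for $k=\infty$, $n$ runs over $\{1,2,\ldots\}$) such that $\chi_{\Omega_0}T=0$; $\chi_{\Omega_\infty}|\lambda_{\infty,n}|\downarrow0$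 (decreasing with infimum $0$ in $L^\infty(\Omega)$); and for all $f\in L^{2,\infty}(S\times\Omega)$ $$T(f)=\chi_{\Omega_\infty}\sum_{n=1}^\infty\lambda_{\infty,n}\langle f,g_{\infty,n}\rangle g_{\infty,n}+\sum_{k=1}^\infty\chi_{\Omega_k}\sum_{n=1}^k\lambda_{k,n}\langle f,g_{k,n}\rangle g_{k,n},$$ where partial sums converge in the $L^\infty(\Omega)$-valued norm $\sqrt{\langle\cdot,\cdot\rangle}$ almost everywhere on $\Omega$. It is known that such a representation exists. Here $\chi_A$ is the indicator function of $A$.
   Formalization: The "if" direction fails when λ vanishes on a non-null set (e.g. λ=0, λ_{k,n}=0 off Ω_k), so the equivalence is stated for λ≠0 a.e.; for general λ, "only if" holds as stated and "if" holds when also π ≤ χ_{Ω_k}. *)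

theory Defs
  imports "HOL-Analysis.Analysis" "HOL-Library.Extended_Nat"
begin

text \<open>
  Elements of the function spaces are represented by functions, and equality of classes is
  equality almost everywhere.  On \<open>S \<times> \<Omega>\<close> "almost everywhere" means: for almost every \<open>\<omega>\<close>, for
  almost every \<open>s\<close>.  This is the equality for which the \<open>L\<^sup>\<infinity>\<close>-valued inner product is definite.
  The measure \<open>S \<Otimes>\<^sub>M M\<close> is used only for its sigma-algebra, because neither factor is
  assumed to be sigma-finite.
\<close>

text \<open>The index set \<open>J\<close> of the family may be taken to be the family itself.\<close>

definition direct_sum_property :: "'w measure \<Rightarrow> bool" where
  "direct_sum_property M \<longleftrightarrow>
     (\<exists>F. F \<subseteq> sets M \<and> (\<forall>X\<in>F. 0 < emeasure M X \<and> emeasure M X < \<infinity>) \<and>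
       (\<forall>A\<in>sets M. emeasure M A < \<infinity> \<longrightarrow>
          (\<exists>F0 B. F0 \<subseteq> F \<and> countable F0 \<and> B \<in> null_sets M \<and> A = (\<Union>X\<in>F0. A \<inter> X) \<union> B)))"

definition Linf :: "'w measure \<Rightarrow> ('w \<Rightarrow> complex) set" where
  "Linf M = {a \<in> borel_measurable M. \<exists>C. AE \<omega> in M. norm (a \<omega>) \<le> C}"

definition Linf_idempotents :: "'w measure \<Rightarrow> ('w \<Rightarrow> complex) set" where
  "Linf_idempotents M = {p \<in> Linf M. AE \<omega> in M. p \<omega> * p \<omega> = p \<omega>}"

text \<open>Membership in \<open>L\<^sup>\<infinity>\<close> for a nonnegative function given as a (possibly infinite) integral.\<close>

definition ennreal_Linf :: "'w measure \<Rightarrow> ('w \<Rightarrow> ennreal) \<Rightarrow> bool" where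
  "ennreal_Linf M h \<longleftrightarrow> h \<in> borel_measurable M \<and> (\<exists>C::real. AE \<omega> in M. h \<omega> \<le> ennreal C)"

text \<open>The square \<open>\<langle>f, f\<rangle>\<close> of the \<open>L\<^sup>\<infinity>\<close>-valued norm, as an extended nonnegative function, so that a
  function that fails to be square integrable on a fibre has norm \<open>\<infinity>\<close> there and not \<open>0\<close>.\<close>

definition Linf_norm_sq :: "'s measure \<Rightarrow> ('s \<times> 'w \<Rightarrow> complex) \<Rightarrow> 'w \<Rightarrow> ennreal" where
  "Linf_norm_sq S f \<omega> = (\<integral>\<^sup>+ s. ennreal ((norm (f (s, \<omega>)))\<^sup>2) \<partial>S)"

definition L2inf :: "'s measure \<Rightarrow> 'w measure \<Rightarrow> ('s \<times> 'w \<Rightarrow> complex) set" where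
  "L2inf S M = {f \<in> borel_measurable (S \<Otimes>\<^sub>M M). ennreal_Linf M (Linf_norm_sq S f)}"

definition Linf_inner ::
  "'s measure \<Rightarrow> ('s \<times> 'w \<Rightarrow> complex) \<Rightarrow> ('s \<times> 'w \<Rightarrow> complex) \<Rightarrow> 'w \<Rightarrow> complex" where
  "Linf_inner S f g \<omega> = (\<integral> s. f (s, \<omega>) * cnj (g (s, \<omega>)) \<partial>S)"

definition partial_integral_operator ::
  "'s measure \<Rightarrow> ('s \<times> 's \<times> 'w \<Rightarrow> complex) \<Rightarrow> ('s \<times> 'w \<Rightarrow> complex) \<Rightarrow> 's \<times> 'w \<Rightarrow> complex" where
  "partial_integral_operator S k f = (\<lambda>(t, \<omega>). \<integral> s. k (t, s, \<omega>) * f (s, \<omega>) \<partial>S)"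

text \<open>The indices \<open>n\<close> belonging to \<open>k \<in> {0, 1, 2, \<dots>, \<infinity>}\<close>: \<open>1, \<dots>, k\<close>, all \<open>n \<ge> 1\<close> if \<open>k = \<infinity>\<close>, and
  none if \<open>k = 0\<close>.\<close>

definition rep_indices :: "enat \<Rightarrow> nat set" where
  "rep_indices k = {n. 1 \<le> n \<and> enat n \<le> k}"

text \<open>The two series are truncated at the same \<open>N\<close>.  Since the \<open>\<Omega>\<^sub>k\<close> are disjoint, over each point
  of \<open>\<Omega>\<close> only one of the two has nonzero terms.\<close>

definition rep_partial_sum ::
  "'s measure \<Rightarrow> (enat \<Rightarrow> 'w set) \<Rightarrow> (enat \<Rightarrow> nat \<Rightarrow> 's \<times> 'w \<Rightarrow> complex) \<Rightarrow>
   (enat \<Rightarrow> nat \<Rightarrow> 'w \<Rightarrow> complex) \<Rightarrow> ('s \<times> 'w \<Rightarrow> complex) \<Rightarrow> nat \<Rightarrow> 's \<times> 'w \<Rightarrow> complex" where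
  "rep_partial_sum S Om g lam f N = (\<lambda>(t, \<omega>).
     indicator (Om \<infinity>) \<omega> *
       (\<Sum>n=1..N. lam \<infinity> n \<omega> * Linf_inner S f (g \<infinity> n) \<omega> * g \<infinity> n (t, \<omega>)) +
     (\<Sum>k=1..N. indicator (Om (enat k)) \<omega> *
       (\<Sum>n=1..k. lam (enat k) n \<omega> * Linf_inner S f (g (enat k) n) \<omega> * g (enat k) n (t, \<omega>))))"

text \<open>The sequence \<open>\<chi>\<^sub>\<Omega>\<^sub>\<infinity> |\<lambda>\<^sub>\<infinity>\<^sub>,\<^sub>n|\<close> has infimum \<open>0\<close> in the order of \<open>L\<^sup>\<infinity>\<close>: every lower bound is \<open>\<le> 0\<close>.
  Convergence in the norm is expressed by that of its square.\<close>

definition spectral_representation ::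
  "'s measure \<Rightarrow> 'w measure \<Rightarrow> (('s \<times> 'w \<Rightarrow> complex) \<Rightarrow> 's \<times> 'w \<Rightarrow> complex) \<Rightarrow>
   (enat \<Rightarrow> 'w set) \<Rightarrow> (enat \<Rightarrow> nat \<Rightarrow> 's \<times> 'w \<Rightarrow> complex) \<Rightarrow>
   (enat \<Rightarrow> nat \<Rightarrow> 'w \<Rightarrow> complex) \<Rightarrow> bool" where
  "spectral_representation S M T Om g lam \<longleftrightarrow>
     (\<forall>k. Om k \<in> sets M) \<and> disjoint_family Om \<and> (\<Union>k. Om k) = space M \<and>
     (\<forall>k. \<forall>n\<in>rep_indices k. g k n \<in> L2inf S M \<and>
        (AE \<omega> in M. \<omega> \<notin> Om k \<longrightarrow> (AE s in S. g k n (s, \<omega>) = 0))) \<and>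
     (\<forall>k. \<forall>n\<in>rep_indices k. \<forall>m\<in>rep_indices k. AE \<omega> in M.
        Linf_inner S (g k n) (g k m) \<omega> = (if n = m then indicator (Om k) \<omega> else 0)) \<and>
     (\<forall>k. \<forall>n\<in>rep_indices k. lam k n \<in> Linf M \<and>
        (AE \<omega> in M. \<omega> \<notin> Om k \<longrightarrow> lam k n \<omega> = 0)) \<and>
     (\<forall>f\<in>L2inf S M. AE \<omega> in M. \<omega> \<in> Om 0 \<longrightarrow> (AE t in S. T f (t, \<omega>) = 0)) \<and>
     (\<forall>n\<ge>1. AE \<omega> in M.
        indicator (Om \<infinity>) \<omega> * norm (lam \<infinity> (Suc n) \<omega>) \<le> indicator (Om \<infinity>) \<omega> * norm (lam \<infinity> n \<omega>)) \<and>
     (\<forall>a :: 'w \<Rightarrow> real. (\<lambda>\<omega>. complex_of_real (a \<omega>)) \<in> Linf M \<longrightarrow>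
        (\<forall>n\<ge>1. AE \<omega> in M. a \<omega> \<le> indicator (Om \<infinity>) \<omega> * norm (lam \<infinity> n \<omega>)) \<longrightarrow>
        (AE \<omega> in M. a \<omega> \<le> 0)) \<and>
     (\<forall>f\<in>L2inf S M. AE \<omega> in M.
        (\<lambda>N. Linf_norm_sq S (\<lambda>x. T f x - rep_partial_sum S Om g lam f N x) \<omega>) \<longlonglongrightarrow> 0)"

definition partial_integral_eq_solvable ::
  "'s measure \<Rightarrow> 'w measure \<Rightarrow> ('s \<times> 's \<times> 'w \<Rightarrow> complex) \<Rightarrow> ('w \<Rightarrow> complex) \<Rightarrow> bool" where
  "partial_integral_eq_solvable S M k l \<longleftrightarrow>
     (\<exists>f\<in>L2inf S M. \<not> (AE \<omega> in M. AE s in S. f (s, \<omega>) = 0) \<and>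
        (AE \<omega> in M. AE t in S. (\<integral> s. k (t, s, \<omega>) * f (s, \<omega>) \<partial>S) = l \<omega> * f (t, \<omega>)))"

end

theory Submission
  imports Defs
begin

text \<open>
  Fix a generic \<open>\<omega> \<in> \<Omega>\<^sub>j\<close>.  Pairing the expansion of \<open>T f = l f\<close> with \<open>g\<^sub>j\<^sub>,\<^sub>n\<close> gives
  \<open>(l(\<omega>) - \<lambda>\<^sub>j\<^sub>,\<^sub>n(\<omega>)) \<langle>f, g\<^sub>j\<^sub>,\<^sub>n\<rangle>(\<omega>) = 0\<close>.  If \<open>l\<close> avoids \<open>0\<close> and, as there are countably many, all
  the \<open>\<lambda>\<^sub>j\<^sub>,\<^sub>n\<close> almost everywhere, then the coefficients of \<open>f\<close> vanish, hence so do \<open>T f\<close> and \<open>f\<close>.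
  Conversely, if \<open>\<pi> l = \<pi> \<lambda>\<^sub>j\<^sub>,\<^sub>n\<close> and \<open>\<pi>\<close> lives on \<open>\<Omega>\<^sub>j\<close>, then \<open>\<pi> g\<^sub>j\<^sub>,\<^sub>n\<close> is a solution; the
  condition on \<open>\<pi>\<close> is automatic where \<open>l \<noteq> 0\<close> because \<open>\<lambda>\<^sub>j\<^sub>,\<^sub>n\<close> is zero off \<open>\<Omega>\<^sub>j\<close>.
\<close>

section \<open>Square-integrable functions and orthonormal expansions on a single measure
  space\<close>

lemma borel_measurable_cnj[measurable]: "cnj \<in> borel_measurable borel"
  by (intro borel_measurable_continuous_onI continuous_intros)

lemma integrable_mult_cnj:
  fixes F G :: "'a \<Rightarrow> complex"
  assumes [measurable]: "F \<in> borel_measurable N" "G \<in> borel_measurable N"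
    and "(\<integral>\<^sup>+ x. ennreal ((norm (F x))\<^sup>2) \<partial>N) < \<infinity>" "(\<integral>\<^sup>+ x. ennreal ((norm (G x))\<^sup>2) \<partial>N) < \<infinity>"
  shows "integrable N (\<lambda>x. F x * cnj (G x))"
proof (rule Bochner_Integration.integrable_bound)
  have "integrable N (\<lambda>x. (norm (F x))\<^sup>2)" "integrable N (\<lambda>x. (norm (G x))\<^sup>2)"
    using assms by (auto simp: integrable_iff_bounded)
  then show "integrable N (\<lambda>x. (norm (F x))\<^sup>2 + (norm (G x))\<^sup>2)"
    by simp
  have "norm (F x * cnj (G x)) \<le> norm ((norm (F x))\<^sup>2 + (norm (G x))\<^sup>2)" for x
  proof -
    have "norm (F x) * norm (G x) \<le> (norm (F x))\<^sup>2 + (norm (G x))\<^sup>2"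
      using sum_squares_bound[of "norm (F x)" "norm (G x)"]
        mult_nonneg_nonneg[OF norm_ge_zero norm_ge_zero, of "F x" "G x"] by linarith
    then show ?thesis
      by (simp add: norm_mult)
  qed
  then show "AE x in N. norm (F x * cnj (G x)) \<le> norm ((norm (F x))\<^sup>2 + (norm (G x))\<^sup>2)"
    by simp
qed measurable

text \<open>A product that is not integrable has Bochner integral 0, so the bound is trivial in that
  case. Otherwise the norm moves inside the integral and the inequality for nonnegative functions
  applies.\<close>

lemma Cauchy_Schwarz_integral_cnj:
  fixes F G :: "'a \<Rightarrow> complex"
  assumes [measurable]: "F \<in> borel_measurable N" "G \<in> borel_measurable N"
  shows "ennreal ((norm (\<integral> x. F x * cnj (G x) \<partial>N))\<^sup>2)
    \<le> (\<integral>\<^sup>+ x. ennreal ((norm (F x))\<^sup>2) \<partial>N) * (\<integral>\<^sup>+ x. ennreal ((norm (G x))\<^sup>2) \<partial>N)"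
proof (cases "integrable N (\<lambda>x. F x * cnj (G x))")
  case True
  have "ennreal ((norm (\<integral> x. F x * cnj (G x) \<partial>N))\<^sup>2)
      = (ennreal (norm (\<integral> x. F x * cnj (G x) \<partial>N)))\<^sup>2"
    by (simp add: ennreal_power)
  also have "\<dots> \<le> (\<integral>\<^sup>+ x. ennreal (norm (F x * cnj (G x))) \<partial>N)\<^sup>2"
    using integral_norm_bound_ennreal[OF True] by (intro power_mono) auto
  also have "\<dots> = (\<integral>\<^sup>+ x. ennreal (norm (F x)) * ennreal (norm (G x)) \<partial>N)\<^sup>2"
    by (simp add: norm_mult ennreal_mult)
  also have "\<dots> \<le> (\<integral>\<^sup>+ x. (ennreal (norm (F x)))\<^sup>2 \<partial>N) * (\<integral>\<^sup>+ x. (ennreal (norm (G x)))\<^sup>2 \<partial>N)"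
    by (rule Cauchy_Schwarz_nn_integral) measurable
  finally show ?thesis
    by (simp add: ennreal_power)
qed (simp add: not_integrable_integral_eq)

text \<open>This is the situation over one point \<omega>: \<open>a\<close> stands for the value of
  \<open>l\<close> and \<open>c n\<close> for the eigenvalues there. An arbitrary index set
  \<open>I\<close> treats finite and infinite expansions together. The vanishing residual kills
  every coefficient of \<open>F\<close>, because \<open>a\<close> differs from \<open>c n\<close>;
  then \<open>a * F\<close> is 0, and so is \<open>F\<close>.\<close>

lemma orthonormal_expansion_no_eigenvector:
  fixes F :: "'a \<Rightarrow> complex" and G :: "nat \<Rightarrow> 'a \<Rightarrow> complex"
  assumes F[measurable]: "F \<in> borel_measurable N"
    and F2: "(\<integral>\<^sup>+ x. ennreal ((norm (F x))\<^sup>2) \<partial>N) < \<infinity>"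
    and G: "\<And>n. n \<in> I \<Longrightarrow> G n \<in> borel_measurable N"
    and G2: "\<And>n. n \<in> I \<Longrightarrow> (\<integral>\<^sup>+ x. ennreal ((norm (G n x))\<^sup>2) \<partial>N) < \<infinity>"
    and orth: "\<And>n m. n \<in> I \<Longrightarrow> m \<in> I \<Longrightarrow>
      (\<integral> x. G n x * cnj (G m x) \<partial>N) = (if n = m then 1 else 0)"
    and lim: "(\<lambda>K. \<integral>\<^sup>+ x. ennreal ((norm (a * F x -
        (\<Sum>n\<in>I \<inter> {..K}. c n * (\<integral> y. F y * cnj (G n y) \<partial>N) * G n x)))\<^sup>2) \<partial>N) \<longlonglongrightarrow> 0"
    and "a \<noteq> 0" and ne: "\<And>n. n \<in> I \<Longrightarrow> a \<noteq> c n"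
  shows "AE x in N. F x = 0"
proof -
  define b where "b n = (\<integral> y. F y * cnj (G n y) \<partial>N)" for n
  define D where "D K x = a * F x - (\<Sum>n\<in>I \<inter> {..K}. c n * b n * G n x)" for K x
  have D[measurable]: "D K \<in> borel_measurable N" for K
    unfolding D_def using G by (intro borel_measurable_diff borel_measurable_sum
        borel_measurable_times borel_measurable_const F) auto
  have lim: "(\<lambda>K. \<integral>\<^sup>+ x. ennreal ((norm (D K x))\<^sup>2) \<partial>N) \<longlonglongrightarrow> 0"
    using lim by (simp add: D_def b_def)
  have b0: "b m = 0" if m: "m \<in> I" for m
  proof -
    \<comment> \<open>Once \<open>K\<close> reaches \<open>m\<close>, the term of index
      \<open>m\<close> is in the partial sum and the pairing no longer depends on
      \<open>K\<close>.\<close>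
    have *: "(\<integral> x. D K x * cnj (G m x) \<partial>N) = (a - c m) * b m" if "K \<ge> m" for K
    proof -
      have "(\<integral> x. D K x * cnj (G m x) \<partial>N)
          = (\<integral> x. a * (F x * cnj (G m x))
              - (\<Sum>n\<in>I \<inter> {..K}. c n * b n * (G n x * cnj (G m x))) \<partial>N)"
        by (simp add: D_def algebra_simps sum_distrib_left)
      also have "\<dots> = (\<integral> x. a * (F x * cnj (G m x)) \<partial>N)
          - (\<integral> x. (\<Sum>n\<in>I \<inter> {..K}. c n * b n * (G n x * cnj (G m x))) \<partial>N)"
        by (intro Bochner_Integration.integral_diff integrable_mult_right
            Bochner_Integration.integrable_sum integrable_mult_cnj G G2 F F2 m) auto
      also have "(\<integral> x. (\<Sum>n\<in>I \<inter> {..K}. c n * b n * (G n x * cnj (G m x))) \<partial>N)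
          = (\<Sum>n\<in>I \<inter> {..K}. (\<integral> x. c n * b n * (G n x * cnj (G m x)) \<partial>N))"
        by (intro Bochner_Integration.integral_sum integrable_mult_right
            integrable_mult_cnj G G2 m) auto
      also have "\<dots> = (\<Sum>n\<in>I \<inter> {..K}. if n = m then c m * b m else 0)"
        using orth m by (intro sum.cong) auto
      also have "\<dots> = c m * b m"
        using m that by simp
      finally show ?thesis
        by (simp add: b_def algebra_simps)
    qed
    \<comment> \<open>By Cauchy-Schwarz the constant pairing is bounded by a product tending to 0;
      the finite norm of \<open>G m\<close> excludes the form 0 times infinity in that
      limit.\<close>
    have "ennreal ((norm ((a - c m) * b m))\<^sup>2) \<le> 0"
    proof (rule tendsto_lowerbound)
      have "(\<lambda>K. (\<integral>\<^sup>+ x. ennreal ((norm (D K x))\<^sup>2) \<partial>N)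
          * (\<integral>\<^sup>+ x. ennreal ((norm (G m x))\<^sup>2) \<partial>N)) \<longlonglongrightarrow>
          0 * (\<integral>\<^sup>+ x. ennreal ((norm (G m x))\<^sup>2) \<partial>N)"
        using lim G2[OF m] by (intro tendsto_mult_ennreal tendsto_const) auto
      then show "(\<lambda>K. (\<integral>\<^sup>+ x. ennreal ((norm (D K x))\<^sup>2) \<partial>N)
          * (\<integral>\<^sup>+ x. ennreal ((norm (G m x))\<^sup>2) \<partial>N)) \<longlonglongrightarrow> 0"
        by simp
      show "\<forall>\<^sub>F K in sequentially. ennreal ((norm ((a - c m) * b m))\<^sup>2)
          \<le> (\<integral>\<^sup>+ x. ennreal ((norm (D K x))\<^sup>2) \<partial>N) * (\<integral>\<^sup>+ x. ennreal ((norm (G m x))\<^sup>2) \<partial>N)"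
        using eventually_ge_at_top[of m]
      proof eventually_elim
        case (elim K)
        show ?case
          using Cauchy_Schwarz_integral_cnj[OF D G[OF m], of K] by (simp add: *[OF elim])
      qed
    qed simp
    then show ?thesis
      using ne[OF m] by (simp add: ennreal_eq_0_iff)
  qed
  \<comment> \<open>With all coefficients 0 the residual is the same for every \<open>K\<close>, so
    its norm is a constant sequence with limit 0.\<close>
  then have "D K x = a * F x" for K x
    by (simp add: D_def)
  then have "(\<integral>\<^sup>+ x. ennreal ((norm (a * F x))\<^sup>2) \<partial>N) = 0"
    using lim LIMSEQ_const_iff by auto
  then show ?thesis
    using \<open>a \<noteq> 0\<close> by (subst (asm) nn_integral_0_iff_AE) auto
qed

text \<open>No measure is assumed to be sigma-finite, but a square integrable \<open>F\<close> is supported on a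
  sigma-finite set, so it suffices to integrate against the finite measure with density \<open>|F|\<^sup>2\<close>.\<close>

lemma borel_measurable_integral_mult_square_integrable:
  fixes F :: "'a \<Rightarrow> complex" and h :: "'b \<Rightarrow> 'a \<Rightarrow> complex"
  assumes [measurable]: "case_prod h \<in> borel_measurable (L \<Otimes>\<^sub>M N)" "F \<in> borel_measurable N"
    and "(\<integral>\<^sup>+ x. ennreal ((norm (F x))\<^sup>2) \<partial>N) < \<infinity>"
  shows "(\<lambda>t. \<integral> x. h t x * F x \<partial>N) \<in> borel_measurable L"
proof -
  define N' where "N' = density N (\<lambda>x. ennreal ((norm (F x))\<^sup>2))"
  have "finite_measure N'"
  proof
    show "emeasure N' (space N') \<noteq> \<infinity>"
      using assms(3) by (simp add: N'_def emeasure_density cong: nn_integral_cong)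
  qed
  then interpret finite_measure N' .
  have [measurable_cong]: "sets N' = sets N"
    by (simp add: N'_def)
  \<comment> \<open>The density contributes |F|^2, and |F|^2 / cnj F = F. Where \<open>F\<close> is
    0 both integrands are 0, as division by 0 gives 0.\<close>
  have "(\<integral> x. h t x * F x \<partial>N) = (\<integral> x. h t x / cnj (F x) \<partial>N')" if t: "t \<in> space L" for t
  proof -
    have [measurable]: "(\<lambda>x. h t x) \<in> borel_measurable N"
      using measurable_Pair2[OF assms(1) t] by simp
    have "(\<integral> x. h t x / cnj (F x) \<partial>N') = (\<integral> x. (norm (F x))\<^sup>2 *\<^sub>R (h t x / cnj (F x)) \<partial>N)"
      unfolding N'_def by (intro integral_density) auto
    also have "\<dots> = (\<integral> x. h t x * F x \<partial>N)"
    proof (rule Bochner_Integration.integral_cong[OF refl])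
      show "(norm (F x))\<^sup>2 *\<^sub>R (h t x / cnj (F x)) = h t x * F x" for x
        by (cases "F x = 0") (simp_all add: scaleR_conv_of_real complex_norm_square del: of_real_power)
    qed
    finally show ?thesis
      by simp
  qed
  moreover have "(\<lambda>t. \<integral> x. h t x / cnj (F x) \<partial>N') \<in> borel_measurable L"
    by measurable
  ultimately show ?thesis
    by (simp cong: measurable_cong)
qed

section \<open>Fibres over \<Omega> and multiplication by bounded functions\<close>

lemma measurable_section:
  assumes "f \<in> borel_measurable (S \<Otimes>\<^sub>M M)" "\<omega> \<in> space M"
  shows "(\<lambda>s. f (s, \<omega>)) \<in> borel_measurable S"
  using assms by measurable

lemma L2inf_finite_norm:
  assumes "f \<in> L2inf S M"
  shows "AE \<omega> in M. Linf_norm_sq S f \<omega> < \<infinity>"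
proof -
  obtain C :: real where "AE \<omega> in M. Linf_norm_sq S f \<omega> \<le> ennreal C"
    using assms by (auto simp: L2inf_def ennreal_Linf_def)
  then show ?thesis
    by eventually_elim (auto simp: less_top[symmetric] top_unique)
qed

text \<open>On each fibre the squared norm scales by |p|^2. This is used to cut \<open>g j n\<close>
  down by an idempotent.\<close>

lemma Linf_mult_L2inf:
  assumes p: "p \<in> Linf M" and f: "f \<in> L2inf S M"
  shows "(\<lambda>(s, \<omega>). p \<omega> * f (s, \<omega>)) \<in> L2inf S M"
proof -
  have [measurable]: "p \<in> borel_measurable M" "f \<in> borel_measurable (S \<Otimes>\<^sub>M M)"
      "Linf_norm_sq S f \<in> borel_measurable M"
    using p f by (auto simp: Linf_def L2inf_def ennreal_Linf_def)
  have eq: "Linf_norm_sq S (\<lambda>(s, \<omega>). p \<omega> * f (s, \<omega>)) \<omega>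
      = ennreal ((norm (p \<omega>))\<^sup>2) * Linf_norm_sq S f \<omega>" if "\<omega> \<in> space M" for \<omega>
  proof -
    have [measurable]: "(\<lambda>s. f (s, \<omega>)) \<in> borel_measurable S"
      using that by measurable
    show ?thesis
      unfolding Linf_norm_sq_def
      by (subst nn_integral_cmult[symmetric]) (auto simp: norm_mult power_mult_distrib ennreal_mult)
  qed
  obtain B C :: real where BC: "AE \<omega> in M. norm (p \<omega>) \<le> B" "AE \<omega> in M. Linf_norm_sq S f \<omega> \<le> ennreal C"
    using p f by (auto simp: Linf_def L2inf_def ennreal_Linf_def)
  \<comment> \<open>The real bound \<open>C\<close> may be negative; \<open>max 0 C\<close> lets the
    two bounds multiply in \<open>ennreal\<close>.\<close>
  have "AE \<omega> in M. Linf_norm_sq S (\<lambda>(s, \<omega>). p \<omega> * f (s, \<omega>)) \<omega> \<le> ennreal (B\<^sup>2 * max 0 C)"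
    using BC AE_space
  proof eventually_elim
    case (elim \<omega>)
    have "ennreal ((norm (p \<omega>))\<^sup>2) * Linf_norm_sq S f \<omega> \<le> ennreal (B\<^sup>2) * ennreal (max 0 C)"
      using elim by (intro mult_mono ennreal_leI power_mono)
        (auto intro: order_trans[OF _ ennreal_leI])
    then show ?case
      using elim by (simp add: eq ennreal_mult)
  qed
  moreover have "Linf_norm_sq S (\<lambda>(s, \<omega>). p \<omega> * f (s, \<omega>)) \<in> borel_measurable M"
    by (subst measurable_cong[OF eq]) measurable
  ultimately show ?thesis
    by (auto simp: L2inf_def ennreal_Linf_def)
qed

section \<open>The spectral expansion over a point of \<open>Om j\<close>\<close>

text \<open>Disjointness leaves only the block of \<open>j\<close>. For finite \<open>j\<close> this
  block is complete once \<open>N\<close> reaches \<open>j\<close>, hence the eventual equality; for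
  infinite \<open>j\<close> it holds at every \<open>N\<close>. The intersection with
  \<open>{..N}\<close> describes both cases.\<close>

lemma rep_partial_sum_on_Om:
  assumes disj: "disjoint_family Om" and \<omega>: "\<omega> \<in> Om j"
  shows "\<forall>\<^sub>F N in sequentially. \<forall>t. rep_partial_sum S Om g lam f N (t, \<omega>) =
    (\<Sum>n\<in>rep_indices j \<inter> {..N}. lam j n \<omega> * Linf_inner S f (g j n) \<omega> * g j n (t, \<omega>))"
proof (cases j)
  case (enat m)
  have Om: "indicator (Om i) \<omega> = (if i = j then 1 else 0 :: complex)" for i
    using disj \<omega> by (auto simp: disjoint_family_on_def indicator_def)
  show ?thesis
    using eventually_ge_at_top[of m]
  proof eventually_elim
    case (elim N)
    have I: "rep_indices j \<inter> {..N} = {1..m}"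
      using elim by (auto simp: rep_indices_def enat)
    show ?case
    proof
      fix t
      define X where "X i = (\<Sum>n=1..i. lam (enat i) n \<omega> * Linf_inner S f (g (enat i) n) \<omega>
        * g (enat i) n (t, \<omega>))" for i
      have "rep_partial_sum S Om g lam f N (t, \<omega>) = (\<Sum>i=1..N. indicator (Om (enat i)) \<omega> * X i)"
        by (simp add: rep_partial_sum_def Om[of \<infinity>] enat X_def)
      also have "\<dots> = (\<Sum>i=1..N. if i = m then X m else 0)"
        unfolding Om enat by (intro sum.cong) auto
      \<comment> \<open>The index \<open>m = 0\<close> is outside the range of summation, but
        \<open>X 0\<close> is an empty sum.\<close>
      also have "\<dots> = X m"
        using elim by (cases m) (auto simp: X_def)
      finally show "rep_partial_sum S Om g lam f N (t, \<omega>) = (\<Sum>n\<in>rep_indices j \<inter> {..N}.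
          lam j n \<omega> * Linf_inner S f (g j n) \<omega> * g j n (t, \<omega>))"
        unfolding I by (simp add: X_def enat)
    qed
  qed
next
  case infinity
  have Om: "indicator (Om i) \<omega> = (if i = j then 1 else 0 :: complex)" for i
    using disj \<omega> by (auto simp: disjoint_family_on_def indicator_def)
  have I: "rep_indices j \<inter> {..N} = {1..N}" for N
    by (auto simp: rep_indices_def infinity)
  show ?thesis
    unfolding rep_partial_sum_def prod.case Om infinity
    by (simp add: I[unfolded infinity])
qed

context
  fixes S :: "'s measure" and M :: "'w measure" and T Om g lam
  assumes rep: "spectral_representation S M T Om g lam"
begin

lemma disjoint_family_Om: "disjoint_family Om"
  using rep by (simp add: spectral_representation_def)

lemma UN_Om: "(\<Union>j. Om j) = space M"
  using rep by (simp add: spectral_representation_def)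

lemma g_L2inf: "n \<in> rep_indices j \<Longrightarrow> g j n \<in> L2inf S M"
  using rep by (simp add: spectral_representation_def)

lemma g_orthonormal:
  "n \<in> rep_indices j \<Longrightarrow> m \<in> rep_indices j \<Longrightarrow>
    AE \<omega> in M. Linf_inner S (g j n) (g j m) \<omega> = (if n = m then indicator (Om j) \<omega> else 0)"
  using rep unfolding spectral_representation_def by blast

lemma lam_Linf: "n \<in> rep_indices j \<Longrightarrow> lam j n \<in> Linf M"
  using rep by (simp add: spectral_representation_def)

lemma lam_eq_0: "n \<in> rep_indices j \<Longrightarrow> AE \<omega> in M. \<omega> \<notin> Om j \<longrightarrow> lam j n \<omega> = 0"
  using rep by (simp add: spectral_representation_def)

lemma spectral_limit:
  "f \<in> L2inf S M \<Longrightarrow> AE \<omega> in M.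
    (\<lambda>N. Linf_norm_sq S (\<lambda>x. T f x - rep_partial_sum S Om g lam f N x) \<omega>) \<longlonglongrightarrow> 0"
  using rep unfolding spectral_representation_def by blast

text \<open>Disjointness holds at every point, so the only exceptional set is that of the
  convergence, and one null set serves all \<open>j\<close>.\<close>

lemma spectral_limit_on_Om:
  assumes f: "f \<in> L2inf S M"
  shows "AE \<omega> in M. \<forall>j. \<omega> \<in> Om j \<longrightarrow> (\<lambda>N. \<integral>\<^sup>+ t. ennreal ((norm (T f (t, \<omega>) -
    (\<Sum>n\<in>rep_indices j \<inter> {..N}. lam j n \<omega> * Linf_inner S f (g j n) \<omega> * g j n (t, \<omega>))))\<^sup>2) \<partial>S)
    \<longlonglongrightarrow> 0"
  using spectral_limit[OF f]
proof eventually_elim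
  case (elim \<omega>)
  show ?case
  proof (intro allI impI)
    fix j assume "\<omega> \<in> Om j"
    note ev = rep_partial_sum_on_Om[OF disjoint_family_Om this, of S g lam f]
    show "(\<lambda>N. \<integral>\<^sup>+ t. ennreal ((norm (T f (t, \<omega>) - (\<Sum>n\<in>rep_indices j \<inter> {..N}.
        lam j n \<omega> * Linf_inner S f (g j n) \<omega> * g j n (t, \<omega>))))\<^sup>2) \<partial>S) \<longlonglongrightarrow> 0"
      by (rule Lim_transform_eventually[OF elim], use ev in eventually_elim)
        (simp add: Linf_norm_sq_def)
  qed
qed

section \<open>From a solution to the spectrum\<close>

text \<open>There are countably many pairs \<open>j\<close>, \<open>n\<close>, so orthonormality,
  finite norms and avoidance of the eigenvalues hold off a common null set. On each remaining fibre
  \<open>orthonormal_expansion_no_eigenvector\<close> applies.\<close>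

lemma eigenfunction_zero:
  assumes f: "f \<in> L2inf S M"
    and eig: "AE \<omega> in M. AE t in S. T f (t, \<omega>) = l \<omega> * f (t, \<omega>)"
    and l: "AE \<omega> in M. l \<omega> \<noteq> 0"
    and ne: "\<And>j n. n \<in> rep_indices j \<Longrightarrow> AE \<omega> in M. l \<omega> \<noteq> lam j n \<omega>"
  shows "AE \<omega> in M. AE s in S. f (s, \<omega>) = 0"
proof -
  have ne': "AE \<omega> in M. \<forall>j. \<forall>n\<in>rep_indices j. l \<omega> \<noteq> lam j n \<omega>"
    unfolding AE_all_countable using ne by (intro allI AE_ball_countable') auto
  have g2: "AE \<omega> in M. \<forall>j. \<forall>n\<in>rep_indices j. Linf_norm_sq S (g j n) \<omega> < \<infinity>"
    unfolding AE_all_countable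
    using L2inf_finite_norm[OF g_L2inf] by (intro allI AE_ball_countable') auto
  have orth: "AE \<omega> in M. \<forall>j. \<forall>n\<in>rep_indices j. \<forall>m\<in>rep_indices j.
      Linf_inner S (g j n) (g j m) \<omega> = (if n = m then indicator (Om j) \<omega> else 0)"
    unfolding AE_all_countable
    using g_orthonormal by (intro allI AE_ball_countable') auto
  show ?thesis
    using AE_space eig l ne' g2 orth L2inf_finite_norm[OF f] spectral_limit_on_Om[OF f]
  proof eventually_elim
    case (elim \<omega>)
    \<comment> \<open>Here \<open>j\<close> may be 0; the index set is then empty and the limit
      itself says that \<open>T f\<close> is 0 over the point.\<close>
    from elim(1) obtain j where j: "\<omega> \<in> Om j"
      using UN_Om by auto
    show ?case
    proof (rule orthonormal_expansion_no_eigenvector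
        [where I = "rep_indices j" and G = "\<lambda>n s. g j n (s, \<omega>)" and c = "\<lambda>n. lam j n \<omega>"])
      show "(\<lambda>s. f (s, \<omega>)) \<in> borel_measurable S"
        using f elim(1) by (intro measurable_section) (auto simp: L2inf_def)
      show "(\<lambda>s. g j n (s, \<omega>)) \<in> borel_measurable S" if "n \<in> rep_indices j" for n
        using g_L2inf[OF that] elim(1) by (intro measurable_section) (auto simp: L2inf_def)
      show "(\<integral> s. g j n (s, \<omega>) * cnj (g j m (s, \<omega>)) \<partial>S) = (if n = m then 1 else 0)"
        if "n \<in> rep_indices j" "m \<in> rep_indices j" for n m
        using elim(6) that j unfolding Linf_inner_def by fastforce
      have "(\<integral>\<^sup>+ t. ennreal ((norm (T f (t, \<omega>) - (\<Sum>n\<in>rep_indices j \<inter> {..N}.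
            lam j n \<omega> * Linf_inner S f (g j n) \<omega> * g j n (t, \<omega>))))\<^sup>2) \<partial>S)
          = (\<integral>\<^sup>+ t. ennreal ((norm (l \<omega> * f (t, \<omega>) - (\<Sum>n\<in>rep_indices j \<inter> {..N}.
            lam j n \<omega> * Linf_inner S f (g j n) \<omega> * g j n (t, \<omega>))))\<^sup>2) \<partial>S)" for N
        using elim(2) by (intro nn_integral_cong_AE) auto
      then show "(\<lambda>N. \<integral>\<^sup>+ t. ennreal ((norm (l \<omega> * f (t, \<omega>) - (\<Sum>n\<in>rep_indices j \<inter> {..N}.
          lam j n \<omega> * (\<integral> s. f (s, \<omega>) * cnj (g j n (s, \<omega>)) \<partial>S) * g j n (t, \<omega>))))\<^sup>2) \<partial>S) \<longlonglongrightarrow> 0"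
        using elim(8)[rule_format, OF j] by (simp add: Linf_inner_def)
    qed (use elim in \<open>auto simp: Linf_norm_sq_def\<close>)
  qed
qed

lemma eigenvalue_meets_spectrum:
  assumes f: "f \<in> L2inf S M" "\<not> (AE \<omega> in M. AE s in S. f (s, \<omega>) = 0)"
    and eig: "AE \<omega> in M. AE t in S. T f (t, \<omega>) = l \<omega> * f (t, \<omega>)"
    and l: "l \<in> Linf M"
  shows "\<exists>p\<in>Linf_idempotents M. \<not> (AE \<omega> in M. p \<omega> = 0) \<and>
    (\<exists>j. \<exists>n\<in>rep_indices j. AE \<omega> in M. p \<omega> * l \<omega> = p \<omega> * lam j n \<omega>)"
proof (rule ccontr)
  assume none: "\<not> ?thesis"
  have ne: "AE \<omega> in M. l \<omega> \<noteq> lam j n \<omega>" if n: "n \<in> rep_indices j" for j n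
  proof -
    have [measurable]: "l \<in> borel_measurable M" "lam j n \<in> borel_measurable M"
      using l lam_Linf[OF n] by (auto simp: Linf_def)
    \<comment> \<open>This indicator is an idempotent satisfying the excluded relation, so it must
      vanish almost everywhere.\<close>
    define p :: "'w \<Rightarrow> complex" where "p = indicator {\<omega> \<in> space M. l \<omega> = lam j n \<omega>}"
    have "p \<in> borel_measurable M"
      unfolding p_def by measurable
    moreover have "norm (p \<omega>) \<le> 1" "p \<omega> * p \<omega> = p \<omega>" for \<omega>
      by (auto simp: p_def indicator_def)
    ultimately have "p \<in> Linf_idempotents M"
      by (auto simp: Linf_idempotents_def Linf_def)
    moreover have "p \<omega> * l \<omega> = p \<omega> * lam j n \<omega>" for \<omega>
      by (simp add: p_def indicator_def)
    ultimately have "AE \<omega> in M. p \<omega> = 0"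
      using none n by blast
    with AE_space show ?thesis
      by eventually_elim (auto simp: p_def)
  qed
  \<comment> \<open>\<open>\<lambda>\<^sub>1\<^sub>,\<^sub>1\<close> vanishes off \<open>\<Omega>\<^sub>1\<close> and \<open>\<lambda>\<^sub>2\<^sub>,\<^sub>1\<close> vanishes on it, so avoiding both forces \<open>l \<noteq> 0\<close>.\<close>
  have I: "1 \<in> rep_indices (enat 1)" "1 \<in> rep_indices (enat 2)"
    by (auto simp: rep_indices_def)
  have disj: "Om (enat 1) \<inter> Om (enat 2) = {}"
    using disjoint_family_Om by (auto simp: disjoint_family_on_def)
  have "AE \<omega> in M. l \<omega> \<noteq> 0"
    using ne[OF I(1)] ne[OF I(2)] lam_eq_0[OF I(1)] lam_eq_0[OF I(2)]
  proof eventually_elim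
    case (elim \<omega>)
    with disj show ?case
      by (metis disjoint_iff)
  qed
  from eigenfunction_zero[OF f(1) eig this ne] f(2) show False
    by blast
qed

end

section \<open>From the spectrum to a solution\<close>

text \<open>Where \<open>p\<close> is nonzero, \<open>pOm\<close> gives \<open>g j n\<close> norm 1.
  The pairing of \<open>f\<close> with \<open>g j m\<close> is therefore \<open>p\<close> for
  \<open>m = n\<close> and 0 otherwise, and the expansion reduces to one term, which
  \<open>pl\<close> identifies with \<open>l\<close> times \<open>f\<close>.\<close>

lemma eigenfunction_from_spectrum:
  assumes k: "k \<in> borel_measurable (S \<Otimes>\<^sub>M S \<Otimes>\<^sub>M M)"
    and rep: "spectral_representation S M (partial_integral_operator S k) Om g lam"
    and p: "p \<in> Linf_idempotents M" "\<not> (AE \<omega> in M. p \<omega> = 0)"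
    and n: "n \<in> rep_indices j"
    and pl: "AE \<omega> in M. p \<omega> * l \<omega> = p \<omega> * lam j n \<omega>"
    and pOm: "AE \<omega> in M. p \<omega> \<noteq> 0 \<longrightarrow> \<omega> \<in> Om j"
  shows "partial_integral_eq_solvable S M k l"
proof -
  define f where "f = (\<lambda>(s, \<omega>). p \<omega> * g j n (s, \<omega>))"
  have fL2: "f \<in> L2inf S M"
    unfolding f_def using p g_L2inf[OF rep n]
    by (intro Linf_mult_L2inf) (auto simp: Linf_idempotents_def)
  have inner: "AE \<omega> in M. \<forall>m\<in>rep_indices j. Linf_inner S (g j n) (g j m) \<omega>
      = (if n = m then indicator (Om j) \<omega> else 0)"
    using g_orthonormal[OF rep n] by (intro AE_ball_countable') auto
  \<comment> \<open>If \<open>f\<close> were zero, the inner product of \<open>g j n\<close> with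
    itself would vanish wherever \<open>p\<close> is nonzero, although it is 1 there.\<close>
  have "AE \<omega> in M. p \<omega> = 0" if "AE \<omega> in M. AE s in S. f (s, \<omega>) = 0"
    using that inner pOm
  proof eventually_elim
    case (elim \<omega>)
    show ?case
    proof (rule ccontr)
      assume "p \<omega> \<noteq> 0"
      then have "Linf_inner S (g j n) (g j n) \<omega> = (\<integral> s. 0 \<partial>S)"
        unfolding Linf_inner_def using elim(1)
        by (intro integral_eq_zero_AE[THEN trans]) (auto simp: f_def)
      with \<open>p \<omega> \<noteq> 0\<close> elim n show False
        by simp
    qed
  qed
  with p have nz: "\<not> (AE \<omega> in M. AE s in S. f (s, \<omega>) = 0)"
    by blast
  have "AE \<omega> in M. AE t in S. (\<integral> s. k (t, s, \<omega>) * f (s, \<omega>) \<partial>S) = l \<omega> * f (t, \<omega>)"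
    using AE_space pl pOm inner L2inf_finite_norm[OF fL2] spectral_limit_on_Om[OF rep fL2]
  proof eventually_elim
    case (elim \<omega>)
    have [measurable]: "(\<lambda>s. f (s, \<omega>)) \<in> borel_measurable S"
      using fL2 elim(1) by (intro measurable_section) (auto simp: L2inf_def)
    show ?case
    proof (cases "p \<omega> = 0")
      case True
      then show ?thesis
        by (simp add: f_def)
    next
      case False
      with elim have j: "\<omega> \<in> Om j"
        by blast
      have "(\<Sum>m\<in>rep_indices j \<inter> {..N}. lam j m \<omega> * Linf_inner S f (g j m) \<omega> * g j m (t, \<omega>))
          = l \<omega> * f (t, \<omega>)" if "N \<ge> n" for N t
      proof -
        have "Linf_inner S f (g j m) \<omega> = (if n = m then p \<omega> else 0)" if "m \<in> rep_indices j" for m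
        proof -
          have "Linf_inner S f (g j m) \<omega> = p \<omega> * Linf_inner S (g j n) (g j m) \<omega>"
            by (simp add: Linf_inner_def f_def mult.assoc)
          then show ?thesis
            using elim(4) that j by auto
        qed
        then have "(\<Sum>m\<in>rep_indices j \<inter> {..N}.
              lam j m \<omega> * Linf_inner S f (g j m) \<omega> * g j m (t, \<omega>))
            = (\<Sum>m\<in>rep_indices j \<inter> {..N}. if m = n then lam j n \<omega> * p \<omega> * g j n (t, \<omega>) else 0)"
          by (intro sum.cong) auto
        also have "\<dots> = lam j n \<omega> * p \<omega> * g j n (t, \<omega>)"
          using n that by simp
        finally show ?thesis
          using elim(2) by (simp add: f_def mult_ac) (metis mult.assoc mult.commute)
      qed
      \<comment> \<open>The norms of the residuals are constant from \<open>n\<close> on, so their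
        limit 0 is that constant.\<close>
      then have "\<forall>\<^sub>F N in sequentially. (\<integral>\<^sup>+ t. ennreal ((norm (partial_integral_operator S k f (t, \<omega>)
            - (\<Sum>m\<in>rep_indices j \<inter> {..N}. lam j m \<omega> * Linf_inner S f (g j m) \<omega> * g j m (t, \<omega>))))\<^sup>2) \<partial>S)
          = (\<integral>\<^sup>+ t. ennreal ((norm (partial_integral_operator S k f (t, \<omega>) - l \<omega> * f (t, \<omega>)))\<^sup>2) \<partial>S)"
        by (intro eventually_mono[OF eventually_ge_at_top[of n]]) simp
      from Lim_transform_eventually[OF elim(6)[rule_format, OF j] this]
      have "(\<integral>\<^sup>+ t. ennreal ((norm (partial_integral_operator S k f (t, \<omega>) - l \<omega> * f (t, \<omega>)))\<^sup>2) \<partial>S) = 0"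
        by (simp add: LIMSEQ_const_iff)
      \<comment> \<open>Measurability in \<open>t\<close> is what turns the zero integral into
        equality almost everywhere; it rests on the square integrability of \<open>f\<close> over
        this fibre.\<close>
      moreover have "(\<lambda>t. partial_integral_operator S k f (t, \<omega>)) \<in> borel_measurable S"
        unfolding partial_integral_operator_def prod.case
      proof (rule borel_measurable_integral_mult_square_integrable)
        have "(\<lambda>(t, s). (t, s, \<omega>)) \<in> S \<Otimes>\<^sub>M S \<rightarrow>\<^sub>M S \<Otimes>\<^sub>M S \<Otimes>\<^sub>M M"
          using elim(1) by measurable
        from measurable_compose[OF this k]
        show "(\<lambda>(t, s). k (t, s, \<omega>)) \<in> borel_measurable (S \<Otimes>\<^sub>M S)"
          by (simp add: case_prod_unfold)
      qed (use elim in \<open>auto simp: Linf_norm_sq_def\<close>)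
      ultimately show ?thesis
        by (subst (asm) nn_integral_0_iff_AE) (auto simp: partial_integral_operator_def)
    qed
  qed
  with fL2 nz show ?thesis
    unfolding partial_integral_eq_solvable_def by blast
qed

text \<open>Off \<open>Om j\<close> the function \<open>lam j n\<close> is 0, so wherever
  \<open>l\<close> is 0 there, the relation \<open>p * l = p * lam j n\<close> holds trivially and
  says nothing about the kernel of the operator. The converse therefore asks either that
  \<open>l\<close> be nonzero almost everywhere or that \<open>p\<close> live on
  \<open>Om j\<close>; the forward direction holds for every bounded \<open>l\<close>.\<close>

theorem corollary3p2:
  fixes S :: "'s measure" and M :: "'w measure"
    and k :: "'s \<times> 's \<times> 'w \<Rightarrow> complex" and l :: "'w \<Rightarrow> complex"
    and Om :: "enat \<Rightarrow> 'w set"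
    and g :: "enat \<Rightarrow> nat \<Rightarrow> 's \<times> 'w \<Rightarrow> complex"
    and lam :: "enat \<Rightarrow> nat \<Rightarrow> 'w \<Rightarrow> complex"
  assumes "direct_sum_property M"
    and "k \<in> borel_measurable (S \<Otimes>\<^sub>M S \<Otimes>\<^sub>M M)"
    and "ennreal_Linf M (\<lambda>\<omega>. \<integral>\<^sup>+ s. \<integral>\<^sup>+ t. ennreal ((norm (k (t, s, \<omega>)))\<^sup>2) \<partial>S \<partial>S)"
    and "AE \<omega> in M. AE t in S. AE s in S. k (t, s, \<omega>) = cnj (k (s, t, \<omega>))"
    and "spectral_representation S M (partial_integral_operator S k) Om g lam"
    and "l \<in> Linf M"
  shows
    "((AE \<omega> in M. l \<omega> \<noteq> 0) \<longrightarrow>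
        (partial_integral_eq_solvable S M k l \<longleftrightarrow>
          (\<exists>p\<in>Linf_idempotents M. \<not> (AE \<omega> in M. p \<omega> = 0) \<and>
            (\<exists>j. \<exists>n\<in>rep_indices j. AE \<omega> in M. p \<omega> * l \<omega> = p \<omega> * lam j n \<omega>))))
     \<and> (partial_integral_eq_solvable S M k l \<longrightarrow>
          (\<exists>p\<in>Linf_idempotents M. \<not> (AE \<omega> in M. p \<omega> = 0) \<and>
            (\<exists>j. \<exists>n\<in>rep_indices j. AE \<omega> in M. p \<omega> * l \<omega> = p \<omega> * lam j n \<omega>)))
     \<and> ((\<exists>p\<in>Linf_idempotents M. \<not> (AE \<omega> in M. p \<omega> = 0) \<and>
            (\<exists>j. \<exists>n\<in>rep_indices j. (AE \<omega> in M. p \<omega> * l \<omega> = p \<omega> * lam j n \<omega>) \<and>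
              (AE \<omega> in M. p \<omega> * indicator (Om j) \<omega> = p \<omega>)))
        \<longrightarrow> partial_integral_eq_solvable S M k l)"
proof -
  let ?T = "partial_integral_operator S k"
  let ?meets = "\<exists>p\<in>Linf_idempotents M. \<not> (AE \<omega> in M. p \<omega> = 0) \<and>
    (\<exists>j. \<exists>n\<in>rep_indices j. AE \<omega> in M. p \<omega> * l \<omega> = p \<omega> * lam j n \<omega>)"
  note rep = assms(5)
  have meets: ?meets if "partial_integral_eq_solvable S M k l"
  proof -
    from that obtain f where "f \<in> L2inf S M" "\<not> (AE \<omega> in M. AE s in S. f (s, \<omega>) = 0)"
      "AE \<omega> in M. AE t in S. ?T f (t, \<omega>) = l \<omega> * f (t, \<omega>)"
      by (auto simp: partial_integral_eq_solvable_def partial_integral_operator_def)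
    from eigenvalue_meets_spectrum[OF rep this assms(6)] show ?thesis .
  qed
  have "partial_integral_eq_solvable S M k l" if l: "AE \<omega> in M. l \<omega> \<noteq> 0" and ?meets
  proof -
    from \<open>?meets\<close> obtain p j n where p: "p \<in> Linf_idempotents M" "\<not> (AE \<omega> in M. p \<omega> = 0)"
      and n: "n \<in> rep_indices j" and pl: "AE \<omega> in M. p \<omega> * l \<omega> = p \<omega> * lam j n \<omega>"
      by blast
    \<comment> \<open>Where \<open>p\<close> and \<open>l\<close> are nonzero,
      \<open>lam j n\<close> is nonzero too, which confines the point to
      \<open>Om j\<close>.\<close>
    have "AE \<omega> in M. p \<omega> \<noteq> 0 \<longrightarrow> \<omega> \<in> Om j"
      using l pl lam_eq_0[OF rep n] by eventually_elim auto
    with p n pl show ?thesis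
      by (intro eigenfunction_from_spectrum[OF assms(2) rep])
  qed
  moreover have "partial_integral_eq_solvable S M k l"
    if p: "p \<in> Linf_idempotents M" "\<not> (AE \<omega> in M. p \<omega> = 0)" and n: "n \<in> rep_indices j"
      and pl: "AE \<omega> in M. p \<omega> * l \<omega> = p \<omega> * lam j n \<omega>"
      and pOm: "AE \<omega> in M. p \<omega> * indicator (Om j) \<omega> = p \<omega>" for p j n
  proof -
    have "AE \<omega> in M. p \<omega> \<noteq> 0 \<longrightarrow> \<omega> \<in> Om j"
      using pOm by eventually_elim (auto simp: indicator_def split: if_splits)
    with p n pl show ?thesis
      by (intro eigenfunction_from_spectrum[OF assms(2) rep])
  qed
  ultimately show ?thesis
    using meets by blast
qed

end
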